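(* Let $A$ be the 3-dimensional complex 3-Lie algebra with basis $\{e_1,e_2,e_3\}$ and non-zero product $[e_1,e_2,e_3]=e_1$. If a skew-symmetric linear map $\Delta:A\to A\otimes A\otimes A$ satisfies $$\Delta([x,y,z])=(\mathrm{id}\otimes\mathrm{id}\otimes\mathrm{ad}_{y,z})\Delta(x)+(\mathrm{id}\otimes\mathrm{id}\otimes\mathrm{ad}_{z,x})\Delta(y)+(\mathrm{id}\otimes\mathrm{id}\otimes\mathrm{ad}_{x,y})\Delta(z)\quad\text{for all }x,y,z\in A,$$ then $\Delta=0$. Therefore there is no non-trivial double construction 3-Lie bialgebra for $A$ (i.e. every double construction 3-Lie bialgebra $(A,\Delta)$ has $\Delta=0$).
   Context: A 3-Lie algebra is a vector space $A$ with a trilinear, totally skew-symmetric bracket $[\cdot,\cdot,\cdot]:\otimes^3A\to A$ such that for all $x_1,\dots,x_5\in A$: $[x_1,x_2,[x_3,x_4,x_5]]=[[x_1,x_2,x_3],x_4,x_5]+[x_3,[x_1,x_2,x_4],x_5]+[x_3,x_4,[x_1,x_2,x_5]]$. Put $\mathrm{ad}_{x,y}z=[x,y,z]$. A linear map $\Delta:A\to A\otimes A\otimes A$ with $\Delta(e_i)=\sum_{p,q,r}C_i^{pqr}e_p\otimes e_q\otimes e_r$ is skew-symmetric if each $C_i^{pqr}$ is totally skew-symmetric in $p,q,r$. A double construction 3-Lie bialgebra is a pair $(A,\Delta)$ of a 3-Lie algebra $A$ and a linear map $\Delta:A\to A\otimes A\otimes A$ such that the dual map $\Delta^*:A^*\otimes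 A^*\otimes A^*\to A^*$ defines a 3-Lie algebra structure on $A^*$ and for all $x,y,z\in A$: $\Delta([x,y,z])=(\mathrm{id}\otimes\mathrm{id}\otimes\mathrm{ad}_{y,z})\Delta(x)+(\mathrm{id}\otimes\mathrm{id}\otimes\mathrm{ad}_{z,x})\Delta(y)+(\mathrm{id}\otimes\mathrm{id}\otimes\mathrm{ad}_{x,y})\Delta(z)$ and $\Delta([x,y,z])=(\mathrm{id}\otimes\mathrm{id}\otimes\mathrm{ad}_{y,z})\Delta(x)+(\mathrm{id}\otimes\mathrm{ad}_{y,z}\otimes\mathrm{id})\Delta(x)+(\mathrm{ad}_{y,z}\otimes\mathrm{id}\otimes\mathrm{id})\Delta(x)$. *)

theory Defs
  imports "HOL-Analysis.Analysis" "HOL-Library.Function_Algebras"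
begin

(* A 3-Lie algebra whose underlying space is the subspace V of an ambient complex vector space
   with scalar multiplication s.  The ambient space is there so that one definition covers both
   A itself (V = UNIV) and its dual, which is a subspace of the space of all functions on A. *)
definition three_lie_algebra_on ::
    "(complex \<Rightarrow> 'a \<Rightarrow> 'a) \<Rightarrow> 'a::ab_group_add set \<Rightarrow> ('a \<Rightarrow> 'a \<Rightarrow> 'a \<Rightarrow> 'a) \<Rightarrow> bool" where
  "three_lie_algebra_on s V br \<longleftrightarrow>
     vector_space s \<and> module.subspace s V \<and>
     (\<forall>x\<in>V. \<forall>y\<in>V. \<forall>z\<in>V. br x y z \<in> V) \<and>
     (\<forall>x\<in>V. \<forall>x'\<in>V. \<forall>y\<in>V. \<forall>z\<in>V.
        br (x + x') y z = br x y z + br x' y z \<and>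
        br y (x + x') z = br y x z + br y x' z \<and>
        br y z (x + x') = br y z x + br y z x') \<and>
     (\<forall>c. \<forall>x\<in>V. \<forall>y\<in>V. \<forall>z\<in>V.
        br (s c x) y z = s c (br x y z) \<and>
        br x (s c y) z = s c (br x y z) \<and>
        br x y (s c z) = s c (br x y z)) \<and>
     (\<forall>x\<in>V. \<forall>y\<in>V. \<forall>z\<in>V. br y x z = - br x y z \<and> br x z y = - br x y z) \<and>
     (\<forall>x1\<in>V. \<forall>x2\<in>V. \<forall>x3\<in>V. \<forall>x4\<in>V. \<forall>x5\<in>V.
        br x1 x2 (br x3 x4 x5) =
          br (br x1 x2 x3) x4 x5 + br x3 (br x1 x2 x4) x5 + br x3 x4 (br x1 x2 x5))"

(* The tensor cube of complex^'n is complex^('n * 'n * 'n): the component at (p, q, r) is the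
   coefficient of the product of the p-th, q-th and r-th standard basis vectors. *)
type_synonym 'n tensor3 = "complex ^ ('n \<times> 'n \<times> 'n)"

definition tensor3 :: "complex^'n \<Rightarrow> complex^'n \<Rightarrow> complex^'n \<Rightarrow> 'n::finite tensor3" where
  "tensor3 u v w = (\<chi> i. case i of (p, q, r) \<Rightarrow> u $ p * v $ q * w $ r)"

(* The linear map f \<otimes> g \<otimes> h, for linear f, g, h; see tensor_map_tensor3. *)
definition tensor_map ::
    "(complex^'n \<Rightarrow> complex^'n) \<Rightarrow> (complex^'n \<Rightarrow> complex^'n) \<Rightarrow> (complex^'n \<Rightarrow> complex^'n) \<Rightarrow>
     'n::finite tensor3 \<Rightarrow> 'n tensor3" where
  "tensor_map f g h T =
     (\<Sum>p\<in>UNIV. \<Sum>q\<in>UNIV. \<Sum>r\<in>UNIV.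
        T $ (p, q, r) *s tensor3 (f (axis p 1)) (g (axis q 1)) (h (axis r 1)))"

(* The value of \<alpha> \<otimes> \<beta> \<otimes> \<gamma> on a tensor, for linear forms \<alpha>, \<beta>, \<gamma>; see tensor_pairing_tensor3. *)
definition tensor_pairing ::
    "(complex^'n \<Rightarrow> complex) \<Rightarrow> (complex^'n \<Rightarrow> complex) \<Rightarrow> (complex^'n \<Rightarrow> complex) \<Rightarrow>
     'n::finite tensor3 \<Rightarrow> complex" where
  "tensor_pairing \<alpha> \<beta> \<gamma> T =
     (\<Sum>p\<in>UNIV. \<Sum>q\<in>UNIV. \<Sum>r\<in>UNIV.
        T $ (p, q, r) * (\<alpha> (axis p 1) * \<beta> (axis q 1) * \<gamma> (axis r 1)))"

lemma linear_form_expand: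
  fixes f :: "complex^'n::finite \<Rightarrow> complex"
  assumes "Vector_Spaces.linear (*s) (*) f"
  shows "f u = (\<Sum>p\<in>UNIV. u $ p * f (axis p 1))"
proof -
  interpret f: Vector_Spaces.linear "(*s)" "(*)" f by fact
  have "f u = f (\<Sum>p\<in>UNIV. u $ p *s axis p 1)"
    by (simp add: basis_expansion)
  then show ?thesis by (simp add: f.sum f.scale)
qed

lemma linear_vec_expand:
  fixes f :: "complex^'n::finite \<Rightarrow> complex^'m::finite"
  assumes "Vector_Spaces.linear (*s) (*s) f"
  shows "f u $ i = (\<Sum>p\<in>UNIV. u $ p * f (axis p 1) $ i)"
proof -
  interpret f: Vector_Spaces.linear "(*s)" "(*s)" f by fact
  have "f u = f (\<Sum>p\<in>UNIV. u $ p *s axis p 1)"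
    by (simp add: basis_expansion)
  then show ?thesis by (simp add: f.sum f.scale)
qed

lemma tensor_map_tensor3:
  assumes "Vector_Spaces.linear (*s) (*s) f" "Vector_Spaces.linear (*s) (*s) g"
    "Vector_Spaces.linear (*s) (*s) h"
  shows "tensor_map f g h (tensor3 u v w) = tensor3 (f u) (g v) (h w)"
proof -
  have "tensor_map f g h (tensor3 u v w) $ (i, j, k) = tensor3 (f u) (g v) (h w) $ (i, j, k)"
    for i j k
    unfolding tensor_map_def tensor3_def
    by (simp add: linear_vec_expand[OF assms(1), of u] linear_vec_expand[OF assms(2), of v]
        linear_vec_expand[OF assms(3), of w] sum_product sum_distrib_left sum_distrib_right mult_ac)
      (rule sum.swap)
  then show ?thesis by (simp add: vec_eq_iff)
qed

lemma tensor_pairing_tensor3: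
  assumes "Vector_Spaces.linear (*s) (*) \<alpha>" "Vector_Spaces.linear (*s) (*) \<beta>"
    "Vector_Spaces.linear (*s) (*) \<gamma>"
  shows "tensor_pairing \<alpha> \<beta> \<gamma> (tensor3 u v w) = \<alpha> u * \<beta> v * \<gamma> w"
  unfolding tensor_pairing_def tensor3_def
  by (simp add: linear_form_expand[OF assms(1), of u] linear_form_expand[OF assms(2), of v]
      linear_form_expand[OF assms(3), of w] sum_product sum_distrib_left sum_distrib_right mult_ac)
    (rule sum.swap)

definition is_basis :: "('n::finite \<Rightarrow> complex^'n) \<Rightarrow> bool" where
  "is_basis e \<longleftrightarrow> inj e \<and> vec.independent (range e) \<and> vec.span (range e) = UNIV"

definition skew_symmetric_wrt ::
    "('n::finite \<Rightarrow> complex^'n) \<Rightarrow> (complex^'n \<Rightarrow> 'n tensor3) \<Rightarrow> bool" where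
  "skew_symmetric_wrt e \<Delta> \<longleftrightarrow>
     (\<exists>C. (\<forall>i. \<Delta> (e i) =
             (\<Sum>p\<in>UNIV. \<Sum>q\<in>UNIV. \<Sum>r\<in>UNIV. C i p q r *s tensor3 (e p) (e q) (e r))) \<and>
          (\<forall>i p q r. C i q p r = - C i p q r \<and> C i p r q = - C i p q r))"

definition dual_space :: "(complex^'n::finite \<Rightarrow> complex) set" where
  "dual_space = {\<phi>. Vector_Spaces.linear (*s) (*) \<phi>}"

(* The dual map of \<Delta>, as a ternary operation on linear forms: \<Delta>\<^sup>*(\<alpha> \<otimes> \<beta> \<otimes> \<gamma>) = (\<alpha> \<otimes> \<beta> \<otimes> \<gamma>) \<circ> \<Delta>. *)
definition dual_bracket ::
    "(complex^'n \<Rightarrow> 'n::finite tensor3) \<Rightarrow> (complex^'n \<Rightarrow> complex) \<Rightarrow> (complex^'n \<Rightarrow> complex) \<Rightarrow>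
     (complex^'n \<Rightarrow> complex) \<Rightarrow> (complex^'n \<Rightarrow> complex)" where
  "dual_bracket \<Delta> \<alpha> \<beta> \<gamma> = (\<lambda>x. tensor_pairing \<alpha> \<beta> \<gamma> (\<Delta> x))"

(* br y z is ad_{y,z}, by currying. *)
definition compatible_args ::
    "(complex^'n \<Rightarrow> complex^'n \<Rightarrow> complex^'n \<Rightarrow> complex^'n) \<Rightarrow>
     (complex^'n \<Rightarrow> 'n::finite tensor3) \<Rightarrow> bool" where
  "compatible_args br \<Delta> \<longleftrightarrow>
     (\<forall>x y z. \<Delta> (br x y z) =
        tensor_map id id (br y z) (\<Delta> x) +
        tensor_map id id (br z x) (\<Delta> y) +
        tensor_map id id (br x y) (\<Delta> z))"

definition compatible_slots ::
    "(complex^'n \<Rightarrow> complex^'n \<Rightarrow> complex^'n \<Rightarrow> complex^'n) \<Rightarrow>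
     (complex^'n \<Rightarrow> 'n::finite tensor3) \<Rightarrow> bool" where
  "compatible_slots br \<Delta> \<longleftrightarrow>
     (\<forall>x y z. \<Delta> (br x y z) =
        tensor_map id id (br y z) (\<Delta> x) +
        tensor_map id (br y z) id (\<Delta> x) +
        tensor_map (br y z) id id (\<Delta> x))"

definition double_construction_bialgebra ::
    "(complex^'n \<Rightarrow> complex^'n \<Rightarrow> complex^'n \<Rightarrow> complex^'n) \<Rightarrow>
     (complex^'n \<Rightarrow> 'n::finite tensor3) \<Rightarrow> bool" where
  "double_construction_bialgebra br \<Delta> \<longleftrightarrow>
     three_lie_algebra_on (*s) UNIV br \<and>
     Vector_Spaces.linear (*s) (*s) \<Delta> \<and>
     three_lie_algebra_on (\<lambda>c \<phi> x. c * \<phi> x) dual_space (dual_bracket \<Delta>) \<and>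
     compatible_args br \<Delta> \<and> compatible_slots br \<Delta>"

end

theory Submission
  imports Defs
begin

text \<open>Let \<phi>1, \<phi>2, \<phi>3 be the basis dual to e. Pairing the compatibility condition at (e1, e2, e3)
with \<alpha> \<otimes> \<beta> \<otimes> \<gamma> turns it into
  D1(\<alpha>, \<beta>, \<gamma>) = \<gamma>(e1) (D1(\<alpha>, \<beta>, \<phi>1) + D2(\<alpha>, \<beta>, \<phi>2) + D3(\<alpha>, \<beta>, \<phi>3)),
where Di(\<alpha>, \<beta>, \<gamma>) is the value of \<alpha> \<otimes> \<beta> \<otimes> \<gamma> on \<Delta>(ei). Each Di is alternating, hence determined by
Di(\<phi>1, \<phi>2, \<phi>3). The triple (\<phi>1, \<phi>2, \<phi>3) gives D1 = 0, and then (\<phi>3, \<phi>1, \<phi>1) and (\<phi>1, \<phi>2, \<phi>1)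
give D2 = 0 and D3 = 0. For a double construction bialgebra, the alternation of Di is the
skew-symmetry of the bracket on the dual space.\<close>

lemma linear_tensor_pairing: "Vector_Spaces.linear (*s) (*) (tensor_pairing \<alpha> \<beta> \<gamma>)"
  by unfold_locales
    (simp_all add: tensor_pairing_def algebra_simps sum.distrib sum_distrib_left)

lemma tensor_pairing_sum1:
  "tensor_pairing (\<lambda>v. \<Sum>i\<in>I. c i * \<phi> i v) \<beta> \<gamma> T = (\<Sum>i\<in>I. c i * tensor_pairing (\<phi> i) \<beta> \<gamma> T)"
  unfolding tensor_pairing_def
  by (simp add: sum_distrib_left sum_distrib_right mult_ac sum.swap[of _ I])

lemma tensor_pairing_sum2:
  "tensor_pairing \<alpha> (\<lambda>v. \<Sum>i\<in>I. c i * \<phi> i v) \<gamma> T = (\<Sum>i\<in>I. c i * tensor_pairing \<alpha> (\<phi> i) \<gamma> T)"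
  unfolding tensor_pairing_def
  by (simp add: sum_distrib_left sum_distrib_right mult_ac sum.swap[of _ I])

lemma tensor_pairing_sum3:
  "tensor_pairing \<alpha> \<beta> (\<lambda>v. \<Sum>i\<in>I. c i * \<phi> i v) T = (\<Sum>i\<in>I. c i * tensor_pairing \<alpha> \<beta> (\<phi> i) T)"
  unfolding tensor_pairing_def
  by (simp add: sum_distrib_left sum_distrib_right mult_ac sum.swap[of _ I])

lemma tensor_pairing_scale3:
  "tensor_pairing \<alpha> \<beta> (\<lambda>v. c * \<phi> v) T = c * tensor_pairing \<alpha> \<beta> \<phi> T"
  using tensor_pairing_sum3[where I = "{()}" and c = "\<lambda>_. c" and \<phi> = "\<lambda>_. \<phi>"] by simp

text \<open>Transposition moves the three maps from the tensor to the forms. Expanding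
  \<open>tensor_map\<close> by linearity of the pairing leaves products of images of standard basis
  vectors, on which the pairing factors.\<close>

lemma tensor_pairing_tensor_map:
  assumes "Vector_Spaces.linear (*s) (*) \<alpha>" "Vector_Spaces.linear (*s) (*) \<beta>"
    "Vector_Spaces.linear (*s) (*) \<gamma>"
  shows "tensor_pairing \<alpha> \<beta> \<gamma> (tensor_map f g h T) =
         tensor_pairing (\<alpha> \<circ> f) (\<beta> \<circ> g) (\<gamma> \<circ> h) T"
proof -
  interpret P: Vector_Spaces.linear "(*s)" "(*)" "tensor_pairing \<alpha> \<beta> \<gamma>"
    by (rule linear_tensor_pairing)
  show ?thesis
    unfolding tensor_map_def
    by (simp add: P.sum P.scale tensor_pairing_tensor3[OF assms])
      (simp add: tensor_pairing_def)
qed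

lemma sum_delta3:
  fixes F :: "'i::finite \<Rightarrow> 'j::finite \<Rightarrow> 'k::finite \<Rightarrow> complex"
  shows "(\<Sum>p\<in>UNIV. \<Sum>q\<in>UNIV. \<Sum>r\<in>UNIV. F p q r * ((if i = p then 1 else 0) *
    (if j = q then 1 else 0) * (if k = r then 1 else 0))) = F i j k"
proof -
  \<comment> \<open>The factor \<open>z\<close> absorbs the indicators of the outer indices, so this
    one rule collapses the sum over r and then the sum over q.\<close>
  have *: "(\<Sum>r\<in>UNIV. f r * (z * (if k = r then 1 else 0))) = f k * z"
    for f :: "'l::finite \<Rightarrow> complex" and z k
    by (simp add: mult_delta_right)
  show ?thesis
    by (simp only: *) (simp add: mult_delta_right)
qed

lemma tensor_pairing_components:
  "tensor_pairing (\<lambda>v. v $ i) (\<lambda>v. v $ j) (\<lambda>v. v $ k) T = T $ (i, j, k)"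
  using sum_delta3[of "\<lambda>p q r. T $ (p, q, r)" i j k]
  by (simp add: tensor_pairing_def axis_def)

text \<open>\<open>vec.representation\<close> is indexed by basis vectors; passing to the index type
  is where injectivity of \<open>e\<close> enters.\<close>

definition dual_basis :: "('n::finite \<Rightarrow> complex^'n) \<Rightarrow> 'n \<Rightarrow> complex^'n \<Rightarrow> complex" where
  "dual_basis e p v = vec.representation (range e) v (e p)"

context
  fixes e :: "'n::finite \<Rightarrow> complex^'n"
  assumes basis: "is_basis e"
begin

lemma linear_dual_basis: "Vector_Spaces.linear (*s) (*) (dual_basis e p)"
  using basis unfolding is_basis_def
  by unfold_locales
    (simp_all add: dual_basis_def vec.representation_add vec.representation_scale algebra_simps)

lemma dual_basis_basis: "dual_basis e p (e q) = (if p = q then 1 else 0)"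
  using basis unfolding is_basis_def
  by (auto simp: dual_basis_def vec.representation_basis dest: injD)

lemma dual_basis_expansion: "(\<Sum>p\<in>UNIV. dual_basis e p v *s e p) = v"
proof -
  have "(\<Sum>b\<in>range e. vec.representation (range e) v b *s b) = v"
    using basis unfolding is_basis_def by (intro vec.sum_representation_eq) auto
  then show ?thesis
    using basis unfolding is_basis_def by (simp add: dual_basis_def sum.reindex)
qed

lemma linear_form_dual_basis:
  assumes "Vector_Spaces.linear (*s) (*) \<phi>"
  shows "\<phi> = (\<lambda>v. \<Sum>p\<in>UNIV. \<phi> (e p) * dual_basis e p v)"
proof
  fix v
  interpret \<phi>: Vector_Spaces.linear "(*s)" "(*)" \<phi> by fact
  have "\<phi> v = \<phi> (\<Sum>p\<in>UNIV. dual_basis e p v *s e p)" by (simp add: dual_basis_expansion)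
  then show "\<phi> v = (\<Sum>p\<in>UNIV. \<phi> (e p) * dual_basis e p v)"
    by (simp add: \<phi>.sum \<phi>.scale mult.commute)
qed

text \<open>Tensor entries refer to the standard basis, which may differ from \<open>e\<close>. Each
  entry is a pairing with coordinate forms, and expanding these in the dual basis gives a
  combination of the assumed zeros.\<close>

lemma tensor3_eq_0I:
  assumes "\<And>p q r. tensor_pairing (dual_basis e p) (dual_basis e q) (dual_basis e r) T = 0"
  shows "T = 0"
proof -
  have lin: "Vector_Spaces.linear (*s) (*) (\<lambda>v::complex^'n. v $ i)" for i
    by unfold_locales (simp_all add: algebra_simps)
  have "T $ (i, j, k) = 0" for i j k
    unfolding tensor_pairing_components[symmetric]
    by (subst (1 2 3) linear_form_dual_basis[OF lin])
      (simp add: tensor_pairing_sum1 tensor_pairing_sum2 tensor_pairing_sum3 assms)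
  then show ?thesis by (simp add: vec_eq_iff)
qed

text \<open>Identifies the coefficients in \<open>skew_symmetric_wrt\<close> with values of the
  pairing.\<close>

lemma tensor_pairing_dual_basis_sum:
  "tensor_pairing (dual_basis e i) (dual_basis e j) (dual_basis e k)
     (\<Sum>p\<in>UNIV. \<Sum>q\<in>UNIV. \<Sum>r\<in>UNIV. C p q r *s tensor3 (e p) (e q) (e r)) = C i j k"
proof -
  interpret P: Vector_Spaces.linear "(*s)" "(*)"
      "tensor_pairing (dual_basis e i) (dual_basis e j) (dual_basis e k)"
    by (rule linear_tensor_pairing)
  show ?thesis
    by (simp add: P.sum P.scale tensor_pairing_tensor3 linear_dual_basis dual_basis_basis sum_delta3)
qed

lemma linear_eq_0_on_basis:
  assumes "Vector_Spaces.linear (*s) (*s) (f :: complex^'n \<Rightarrow> complex^'m)" "\<And>i. f (e i) = 0"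
  shows "f = (\<lambda>x. 0)"
proof
  fix x
  interpret f: Vector_Spaces.linear "(*s)" "(*s)" f by fact
  have "f x = f (\<Sum>p\<in>UNIV. dual_basis e p x *s e p)" by (simp add: dual_basis_expansion)
  then show "f x = 0" by (simp add: f.sum f.scale assms(2))
qed

end

text \<open>A repeated index forces a value equal to its own negative; any other triple is a
  permutation of (1, 2, 3), reached by adjacent swaps.\<close>

lemma skew_eq_0:
  fixes D :: "3 \<Rightarrow> 3 \<Rightarrow> 3 \<Rightarrow> complex"
  assumes "\<And>p q r. D q p r = - D p q r" "\<And>p q r. D p r q = - D p q r" "D 1 2 3 = 0"
  shows "D p q r = 0"
proof -
  have diag: "D p p r = 0" "D p r r = 0" for p r
    using assms(1)[of p p r] assms(2)[of p r r] by auto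
  have "D 2 1 3 = 0" "D 1 3 2 = 0" "D 2 3 1 = 0" "D 3 1 2 = 0" "D 3 2 1 = 0" "D p q p = 0" for p q
    using assms diag by (metis neg_equal_0_iff_equal)+
  with diag assms(3) show ?thesis
    using exhaust_3[of p] exhaust_3[of q] exhaust_3[of r] by auto
qed

text \<open>Core shared by both claims. \<open>D\<close> is a parameter so that it can be the
  coefficient family of a skew-symmetric map as well as the values of the dual bracket.\<close>

lemma compatible_args_skew_eq_0:
  fixes br :: "complex^3 \<Rightarrow> complex^3 \<Rightarrow> complex^3 \<Rightarrow> complex^3"
  assumes lie: "three_lie_algebra_on (*s) UNIV br"
    and basis: "is_basis e"
    and prod: "br (e 1) (e 2) (e 3) = e 1"
    and lin: "Vector_Spaces.linear (*s) (*s) \<Delta>"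
    and compat: "compatible_args br \<Delta>"
    and D: "\<And>i p q r. D i p q r =
      tensor_pairing (dual_basis e p) (dual_basis e q) (dual_basis e r) (\<Delta> (e i))"
    and skew: "\<And>i p q r. D i q p r = - D i p q r" "\<And>i p q r. D i p r q = - D i p q r"
  shows "\<Delta> = (\<lambda>x. 0)"
proof -
  let ?\<phi> = "dual_basis e"
  have br_add: "br x y (z + z') = br x y z + br x y z'"
    and br_scale: "br x y (c *s z) = c *s br x y z"
    and br_swap: "br y x z = - br x y z" "br x z y = - br x y z" for x y z z' c
    using lie unfolding three_lie_algebra_on_def by blast+
  have br_diag: "br x x z = 0" "br x z z = 0" "br x z x = 0" for x z
  proof -
    have "br x x z = - br x x z" "br x z z = - br x z z" using br_swap by blast+
    then show "br x x z = 0" "br x z z = 0" by (simp_all add: vec_eq_iff)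
    then show "br x z x = 0" using br_swap(1)[of x z x] br_swap(2)[of z x x]
      by (metis br_swap(2))
  qed
  have cyc: "br y z x = br x y z" for x y z
    using br_swap(1)[of z y x] br_swap(2)[of y z x] br_swap
    by metis
  have prods: "br (e 2) (e 3) (e 1) = e 1" "br (e 3) (e 1) (e 2) = e 1"
    using cyc prod by metis+
  have ad: "br x y v = (\<Sum>p\<in>UNIV. ?\<phi> p v *s br x y (e p))" for x y v
  proof -
    interpret ad: Vector_Spaces.linear "(*s)" "(*s)" "br x y"
      by unfold_locales (simp_all add: br_add br_scale algebra_simps)
    have "br x y v = br x y (\<Sum>p\<in>UNIV. ?\<phi> p v *s e p)"
      by (simp add: dual_basis_expansion[OF basis])
    then show ?thesis by (simp add: ad.sum ad.scale)
  qed
  \<comment> \<open>Skew-symmetry kills all but one basis vector, so the three maps have rank one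
    with the same image, the line through \<open>e 1\<close>.\<close>
  have ads: "br (e 2) (e 3) v = ?\<phi> 1 v *s e 1" "br (e 3) (e 1) v = ?\<phi> 2 v *s e 1"
    "br (e 1) (e 2) v = ?\<phi> 3 v *s e 1" for v
    by (subst ad, simp add: sum_3 br_diag prods prod)+
  \<comment> \<open>As the image is the same line each time, one scalar
    \<open>?\<phi> r (e 1)\<close> factors out of all three terms of the condition.\<close>
  have pull: "?\<phi> r \<circ> (\<lambda>v. ?\<phi> s v *s e 1) = (\<lambda>v. ?\<phi> r (e 1) * ?\<phi> s v)" for r s
  proof -
    interpret \<phi>: Vector_Spaces.linear "(*s)" "(*)" "?\<phi> r" by (rule linear_dual_basis[OF basis])
    show ?thesis by (auto simp: \<phi>.scale)
  qed
  have main: "D 1 p q r = ?\<phi> r (e 1) * (D 1 p q 1 + D 2 p q 2 + D 3 p q 3)" for p q r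
  proof -
    interpret P: Vector_Spaces.linear "(*s)" "(*)" "tensor_pairing (?\<phi> p) (?\<phi> q) (?\<phi> r)"
      by (rule linear_tensor_pairing)
    have "\<Delta> (e 1) = tensor_map id id (br (e 2) (e 3)) (\<Delta> (e 1)) +
        tensor_map id id (br (e 3) (e 1)) (\<Delta> (e 2)) + tensor_map id id (br (e 1) (e 2)) (\<Delta> (e 3))"
      using compat prod unfolding compatible_args_def by metis
    then have "D 1 p q r = tensor_pairing (?\<phi> p) (?\<phi> q) (?\<phi> r)
       (tensor_map id id (\<lambda>v. ?\<phi> 1 v *s e 1) (\<Delta> (e 1)) +
        tensor_map id id (\<lambda>v. ?\<phi> 2 v *s e 1) (\<Delta> (e 2)) +
        tensor_map id id (\<lambda>v. ?\<phi> 3 v *s e 1) (\<Delta> (e 3)))"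
      unfolding D ads by (rule arg_cong)
    then show ?thesis
      by (simp add: P.add tensor_pairing_tensor_map linear_dual_basis[OF basis] pull
          tensor_pairing_scale3 D distrib_left)
  qed
  \<comment> \<open>With third index 3 the prefactor \<open>?\<phi> 3 (e 1)\<close>
    vanishes.\<close>
  have "D 1 1 2 3 = 0"
    by (subst main) (simp add: dual_basis_basis[OF basis])
  then have D1: "D 1 p q r = 0" for p q r
    using skew_eq_0[of "D 1"] skew by blast
  have rep: "D i p q p = 0" "D i p q q = 0" for i p q
    using skew(1)[of i p p q] skew(2)[of i p p q] skew(2)[of i p q q] by auto
  \<comment> \<open>With third index 1 the prefactor is 1 and, since D1 = 0, \<open>main\<close>
    reads \<open>D 2 p q 2 + D 3 p q 3 = 0\<close>. Each choice of p and q gives one of the two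
    terms a repeated index and so isolates the other.\<close>
  have "D 2 3 1 2 = 0" "D 3 1 2 3 = 0"
    using main[of 3 1 1] main[of 1 2 1] by (simp_all add: D1 rep dual_basis_basis[OF basis])
  moreover have "D 2 1 2 3 = D 2 3 1 2"
    using skew(1)[of 2 3 1 2] skew(2)[of 2 1 3 2] by simp
  ultimately have "D i 1 2 3 = 0" for i
    using exhaust_3[of i] D1 by auto
  then have "D i p q r = 0" for i p q r
    using skew_eq_0[of "D i"] skew by blast
  then have "\<Delta> (e i) = 0" for i
    unfolding D by (rule tensor3_eq_0I[OF basis])
  then show ?thesis by (rule linear_eq_0_on_basis[OF basis lin])
qed

theorem theorem4p3:
  fixes br :: "complex^3 \<Rightarrow> complex^3 \<Rightarrow> complex^3 \<Rightarrow> complex^3"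
    and e :: "3 \<Rightarrow> complex^3"
  assumes "three_lie_algebra_on (*s) UNIV br"
    and "is_basis e"
    and "br (e 1) (e 2) (e 3) = e 1"
  shows "(\<forall>\<Delta>. Vector_Spaces.linear (*s) (*s) \<Delta> \<and> skew_symmetric_wrt e \<Delta> \<and> compatible_args br \<Delta>
              \<longrightarrow> \<Delta> = (\<lambda>x. 0)) \<and>
         (\<forall>\<Delta>. double_construction_bialgebra br \<Delta> \<longrightarrow> \<Delta> = (\<lambda>x. 0))"
proof (intro conjI allI impI; (elim conjE)?)
  fix \<Delta>
  assume lin: "Vector_Spaces.linear (*s) (*s) \<Delta>" and skew: "skew_symmetric_wrt e \<Delta>"
    and compat: "compatible_args br \<Delta>"
  obtain C where C: "\<And>i. \<Delta> (e i) =
      (\<Sum>p\<in>UNIV. \<Sum>q\<in>UNIV. \<Sum>r\<in>UNIV. C i p q r *s tensor3 (e p) (e q) (e r))"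
    "\<And>i p q r. C i q p r = - C i p q r" "\<And>i p q r. C i p r q = - C i p q r"
    using skew unfolding skew_symmetric_wrt_def by blast
  show "\<Delta> = (\<lambda>x. 0)"
    by (rule compatible_args_skew_eq_0[OF assms lin compat, of C])
      (simp_all only: C(1) tensor_pairing_dual_basis_sum[OF assms(2)], rule C, rule C)
next
  fix \<Delta>
  assume *: "double_construction_bialgebra br \<Delta>"
  let ?D = "\<lambda>i p q r. dual_bracket \<Delta> (dual_basis e p) (dual_basis e q) (dual_basis e r) (e i)"
  have dual: "dual_basis e p \<in> dual_space" for p
    by (simp add: dual_space_def linear_dual_basis[OF assms(2)])
  have "three_lie_algebra_on (\<lambda>c \<phi> x. c * \<phi> x) dual_space (dual_bracket \<Delta>)"
    using * by (simp only: double_construction_bialgebra_def)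
  then have "\<forall>\<alpha>\<in>dual_space. \<forall>\<beta>\<in>dual_space. \<forall>\<gamma>\<in>dual_space.
      dual_bracket \<Delta> \<beta> \<alpha> \<gamma> = - dual_bracket \<Delta> \<alpha> \<beta> \<gamma> \<and>
      dual_bracket \<Delta> \<alpha> \<gamma> \<beta> = - dual_bracket \<Delta> \<alpha> \<beta> \<gamma>"
    unfolding three_lie_algebra_on_def by (elim conjE)
  then have
    "dual_bracket \<Delta> (dual_basis e q) (dual_basis e p) (dual_basis e r) =
      - dual_bracket \<Delta> (dual_basis e p) (dual_basis e q) (dual_basis e r)"
    "dual_bracket \<Delta> (dual_basis e p) (dual_basis e r) (dual_basis e q) =
      - dual_bracket \<Delta> (dual_basis e p) (dual_basis e q) (dual_basis e r)" for p q r
    using dual by blast+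
  \<comment> \<open>Negation in the dual space is pointwise, so evaluating these identities of forms
    at \<open>e i\<close> gives the scalar skew-symmetry.\<close>
  from this[THEN fun_cong]
  have skew: "?D i q p r = - ?D i p q r" "?D i p r q = - ?D i p q r" for i p q r
    unfolding fun_Compl_def .
  show "\<Delta> = (\<lambda>x. 0)"
  proof (rule compatible_args_skew_eq_0[OF assms, of \<Delta> ?D])
    show "Vector_Spaces.linear (*s) (*s) \<Delta>" "compatible_args br \<Delta>"
      using * by (simp_all add: double_construction_bialgebra_def)
    show "?D i p q r =
        tensor_pairing (dual_basis e p) (dual_basis e q) (dual_basis e r) (\<Delta> (e i))" for i p q r
      by (simp only: dual_bracket_def)
  qed (fact skew)+
qed

end
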